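(* Let $n\ge 1$. The stability spaces of the modules $M(\epsilon_i)$ and $M(a,b,\eta)$ over $B(n)$ are as follows, where $x\equiv_2y$ means that the integers $x$ and $y$ have the same parity. (1) For $0\le i\le n$, $\mathcal{D}(M(\epsilon_i))=\{(v_n,v_{n-1},\dots,v_0)\in\mathbb{R}^{n+1}\mid v_i=0\}$. (2) For $0\le a<b\le n$, $\mathcal{D}(M(a,b,-1))$ is the set of all $(v_n,v_{n-1},\dots,v_0)\in\mathbb{R}^{n+1}$ such that $v_a+v_{a+1}+\dots+v_b=0$ and $\sum_{i=a'}^{b'}v_i\le0$ for every interval $[a',b']\subseteq[a,b]$ with $a'\equiv_2a$ and ($b'=b$ or $b'\equiv_2a$). (3) For $0\le a<b\le n$, $\mathcal{D}(M(a,b,1))$ is the set of all $(v_n,v_{n-1},\dots,v_0)\in\mathbb{R}^{n+1}$ such that $v_a+v_{a+1}+\dots+v_b=0$ and $\sum_{i=a'}^{b'}v_i\ge0$ for every interval $[a',b']\subseteq[a,b]$ with $a'\equiv_2a$ and ($b'=b$ or $b'\equiv_2a$).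
   Context: Let $n\ge 1$ and let $\mathbb{k}$ be an algebraically closed field; $[i,j]$ denotes the integer interval $\{i,\dots,j\}$. The quiver $Q(n)$ has vertices $0,1,\dots,n$ and arrows $\alpha_i\colon i+1\to i$, $\beta_i\colon i\to i+1$ for $i\in[0,n-1]$. Paths are written right to left ($\gamma\delta$ means first $\delta$, then $\gamma$). $I(n)$ is the ideal of $\mathbb{k}Q(n)$ generated by $\beta_i\alpha_i-\alpha_{i+1}\beta_{i+1}$, $\alpha_i\alpha_{i+1}$, $\beta_{i+1}\beta_i$ for $i\in[0,n-2]$, together with $\alpha_0\beta_0$. Put $B(n)=\mathbb{k}Q(n)/I(n)$. A $B(n)$-module means a finite-dimensional one, identified with a representation of $Q(n)$ satisfying the relations in $I(n)$; its dimension vector is $\dim M=(\dim M_n,\dim M_{n-1},\dots,\dim M_0)$. $M(\epsilon_i)$ is the simple module with $\mathbb{k}$ at vertex $i$ and $0$ elsewhere. For $0\le a<b\le n$ and $\eta\in\{\pm1\}$, $M(a,b,\eta)$ is the string module of the alternating walk $\gamma_{b-a}\cdots\gamma_1$ from $a$ to $b$, where $\gamma_k$ is either the arrow $\beta_{a+k-1}$ or the formal inverse $\alpha_{a+k-1}^*$ of $\alpha_{a+k-1}$, the two kinds alternate, $\gamma_1=\beta_a$ if $\eta=1$, and $\gamma_1=\alpha_a^*$ if $\eta=-1$. Explicitly: $M(a,b,\eta)_j=\mathbb{k}$ for $j\in[a,b]$ and $0$ otherwise. For each $j\in[a,b-1]$, if ($\eta=1$ and $j\equiv_2a$) or ($\eta=-1$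 and $j\not\equiv_2a$), then $\beta_j$ acts as the identity and $\alpha_j$ as $0$; otherwise $\alpha_j$ acts as the identity and $\beta_j$ as $0$. All other arrows act as $0$. (These are, up to isomorphism, all the thin indecomposable $B(n)$-modules, i.e. indecomposable modules with all entries of the dimension vector $\le 1$.) Let $\langle\cdot,\cdot\rangle$ be the standard scalar product on $\mathbb{R}^{n+1}$, whose vectors are written $v=(v_n,\dots,v_0)$. A module $M$ is $v$-semistable if $\langle v,\dim M\rangle=0$ and $\langle v,\dim N\rangle\le0$ for every non-zero proper submodule $N$ of $M$. For $M\neq0$, its stability space is $\mathcal{D}(M)=\{v\in\mathbb{R}^{n+1}\mid M\text{ is }v\text{-semistable}\}$. *)

theory Defs
  imports
    "HOL-Library.Poly_Mapping"
    "HOL-Computational_Algebra.Polynomial"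
    "HOL-Number_Theory.Cong"
    "HOL-Algebra.Ideal"
    "Graph_Theory.Arc_Walk"
    "Jordan_Normal_Form.Matrix"
begin

section \<open>Path algebras\<close>

text \<open>
  A path is a pair \<open>(u, p)\<close> of its start vertex \<open>u\<close> and its arrows \<open>p\<close>, listed in the order of
  traversal; \<open>(u, [])\<close> is the trivial path at \<open>u\<close>. With paths written from right to left,
  the product of \<open>(w, p)\<close> and \<open>(u, q)\<close> is therefore \<open>(u, q @ p)\<close> if \<open>q\<close> ends in \<open>w\<close>, and 0 otherwise.
\<close>

type_synonym ('a, 'b) path = "'a \<times> 'b list"

definition path_end :: "('a, 'b) pre_digraph \<Rightarrow> ('a, 'b) path \<Rightarrow> 'a" where
  "path_end G p = pre_digraph.awlast G (fst p) (snd p)"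

definition paths :: "('a, 'b) pre_digraph \<Rightarrow> ('a, 'b) path set" where
  "paths G = {p. pre_digraph.awalk G (fst p) (snd p) (path_end G p)}"

definition path_mult ::
  "('a, 'b) pre_digraph \<Rightarrow> (('a, 'b) path \<Rightarrow>\<^sub>0 'k::field) \<Rightarrow> (('a, 'b) path \<Rightarrow>\<^sub>0 'k) \<Rightarrow> (('a, 'b) path \<Rightarrow>\<^sub>0 'k)"
where
  "path_mult G x y =
     (\<Sum>p\<in>Poly_Mapping.keys x. \<Sum>q\<in>Poly_Mapping.keys y.
        if path_end G q = fst p
        then Poly_Mapping.single (fst q, snd q @ snd p) (Poly_Mapping.lookup x p * Poly_Mapping.lookup y q)
        else 0)"

definition path_algebra :: "('a, 'b) pre_digraph \<Rightarrow> (('a, 'b) path \<Rightarrow>\<^sub>0 'k::field) ring" where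
  "path_algebra G =
     \<lparr>carrier = {x. Poly_Mapping.keys x \<subseteq> paths G},
      mult = path_mult G,
      one = (\<Sum>u\<in>verts G. Poly_Mapping.single (u, []) 1),
      zero = 0,
      add = (+)\<rparr>"

definition arrow :: "('a, 'b) pre_digraph \<Rightarrow> 'b \<Rightarrow> (('a, 'b) path \<Rightarrow>\<^sub>0 'k::field)" where
  "arrow G e = Poly_Mapping.single (tail G e, [e]) 1"


section \<open>Representations\<close>

text \<open>
  The spaces at the vertices are subspaces of one type \<open>'v\<close>, which is a vector space with the scalar
  multiplication \<open>rscale\<close>. They are independent of each other: vectors at different vertices are
  never added or compared.
\<close>

record ('a, 'b, 'k, 'v) quiver_rep =
  rscale :: "'k \<Rightarrow> 'v \<Rightarrow> 'v"
  rspace :: "'a \<Rightarrow> 'v set"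
  rmap :: "'b \<Rightarrow> 'v \<Rightarrow> 'v"

definition is_rep ::
  "('a, 'b) pre_digraph \<Rightarrow> ('a, 'b, 'k::field, 'v::ab_group_add) quiver_rep \<Rightarrow> bool"
where
  "is_rep G M \<longleftrightarrow>
     vector_space (rscale M) \<and>
     (\<forall>u\<in>verts G. module.subspace (rscale M) (rspace M u) \<and>
        (\<exists>B. finite B \<and> module.span (rscale M) B = rspace M u)) \<and>
     (\<forall>e\<in>arcs G. \<forall>x\<in>rspace M (tail G e).
        rmap M e x \<in> rspace M (head G e) \<and>
        (\<forall>y\<in>rspace M (tail G e). rmap M e (x + y) = rmap M e x + rmap M e y) \<and>
        (\<forall>c. rmap M e (rscale M c x) = rscale M c (rmap M e x)))"

text \<open>
  The component of an element of the path algebra acting from the space at \<open>u\<close> to the space at \<open>w\<close>.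
  Note that \<open>fold\<close> applies the arrows of a path in the order of traversal.
\<close>

definition rep_action ::
  "('a, 'b) pre_digraph \<Rightarrow> ('a, 'b, 'k::field, 'v::ab_group_add) quiver_rep \<Rightarrow>
   (('a, 'b) path \<Rightarrow>\<^sub>0 'k) \<Rightarrow> 'a \<Rightarrow> 'a \<Rightarrow> 'v \<Rightarrow> 'v"
where
  "rep_action G M x u w m =
     (\<Sum>p\<in>{p \<in> Poly_Mapping.keys x. fst p = u \<and> path_end G p = w}.
        rscale M (Poly_Mapping.lookup x p) (fold (rmap M) (snd p) m))"

definition annihilates ::
  "('a, 'b) pre_digraph \<Rightarrow> (('a, 'b) path \<Rightarrow>\<^sub>0 'k::field) \<Rightarrow> ('a, 'b, 'k, 'v::ab_group_add) quiver_rep \<Rightarrow> bool"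
where
  "annihilates G x M \<longleftrightarrow>
     (\<forall>u\<in>verts G. \<forall>w\<in>verts G. \<forall>m\<in>rspace M u. rep_action G M x u w m = 0)"


section \<open>The algebra \<open>B(n)\<close> and its modules\<close>

datatype arrow_name = Alpha nat | Beta nat

definition quiver_Q :: "nat \<Rightarrow> (nat, arrow_name) pre_digraph" where
  "quiver_Q n =
     \<lparr>verts = {0..n},
      arcs = Alpha ` {0..<n} \<union> Beta ` {0..<n},
      tail = (\<lambda>e. case e of Alpha i \<Rightarrow> i + 1 | Beta i \<Rightarrow> i),
      head = (\<lambda>e. case e of Alpha i \<Rightarrow> i | Beta i \<Rightarrow> i + 1)\<rparr>"

text \<open>The range \<open>i \<in> [0, n - 2]\<close> is expressed as \<open>i + 2 \<le> n\<close>; it is empty for \<open>n = 1\<close>.\<close>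

definition relations :: "nat \<Rightarrow> ((nat, arrow_name) path \<Rightarrow>\<^sub>0 'k::field) set" where
  "relations n =
     (let \<alpha> = (\<lambda>i. arrow (quiver_Q n) (Alpha i)); \<beta> = (\<lambda>i. arrow (quiver_Q n) (Beta i)); mul = path_mult (quiver_Q n) in
        {mul (\<beta> i) (\<alpha> i) - mul (\<alpha> (i + 1)) (\<beta> (i + 1)) | i. i + 2 \<le> n} \<union>
        {mul (\<alpha> i) (\<alpha> (i + 1)) | i. i + 2 \<le> n} \<union>
        {mul (\<beta> (i + 1)) (\<beta> i) | i. i + 2 \<le> n} \<union>
        {mul (\<alpha> 0) (\<beta> 0)})"

definition ideal_I :: "nat \<Rightarrow> ((nat, arrow_name) path \<Rightarrow>\<^sub>0 'k::field) set" where
  "ideal_I n = Idl\<^bsub>path_algebra (quiver_Q n)\<^esub> (relations n)"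

type_synonym ('k, 'v) rep = "(nat, arrow_name, 'k, 'v) quiver_rep"

text \<open>Finite-dimensional modules over \<open>B(n) = kQ(n)/I(n)\<close>, as representations bound by \<open>I(n)\<close>.\<close>

definition B_module :: "nat \<Rightarrow> ('k::field, 'v::ab_group_add) rep \<Rightarrow> bool" where
  "B_module n M \<longleftrightarrow> is_rep (quiver_Q n) M \<and> (\<forall>x\<in>ideal_I n. annihilates (quiver_Q n) x M)"

definition submodule :: "nat \<Rightarrow> ('k::field, 'v::ab_group_add) rep \<Rightarrow> ('k, 'v) rep \<Rightarrow> bool" where
  "submodule n N M \<longleftrightarrow>
     B_module n N \<and> rscale N = rscale M \<and>
     (\<forall>i\<in>verts (quiver_Q n). rspace N i \<subseteq> rspace M i) \<and>
     (\<forall>e\<in>arcs (quiver_Q n). \<forall>x\<in>rspace N (tail (quiver_Q n) e). rmap N e x = rmap M e x)"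

definition nonzero_module :: "nat \<Rightarrow> ('k, 'v::ab_group_add) rep \<Rightarrow> bool" where
  "nonzero_module n M \<longleftrightarrow> (\<exists>i\<in>verts (quiver_Q n). rspace M i \<noteq> {0})"

definition proper_submodule :: "nat \<Rightarrow> ('k::field, 'v::ab_group_add) rep \<Rightarrow> ('k, 'v) rep \<Rightarrow> bool" where
  "proper_submodule n N M \<longleftrightarrow> submodule n N M \<and> (\<exists>i\<in>verts (quiver_Q n). rspace N i \<noteq> rspace M i)"

text \<open>
  Elements \<open>(v\<^sub>n, \<dots>, v\<^sub>0)\<close> of the (n+1)-dimensional real space are vectors \<open>v\<close> with
  \<open>v $ i = v\<^sub>i\<close>, that is, coordinates are indexed by the vertices.
\<close>

definition dim_vector :: "nat \<Rightarrow> ('k::field, 'v::ab_group_add) rep \<Rightarrow> real vec" where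
  "dim_vector n M = vec (n + 1) (\<lambda>i. real (vector_space.dim (rscale M) (rspace M i)))"

definition semistable :: "nat \<Rightarrow> real vec \<Rightarrow> ('k::field, 'v::ab_group_add) rep \<Rightarrow> bool" where
  "semistable n v M \<longleftrightarrow>
     B_module n M \<and> v \<bullet> dim_vector n M = 0 \<and>
     (\<forall>N. proper_submodule n N M \<and> nonzero_module n N \<longrightarrow> v \<bullet> dim_vector n N \<le> 0)"

text \<open>Only meant for nonzero \<open>M\<close>.\<close>

definition stability_space :: "nat \<Rightarrow> ('k::field, 'v::ab_group_add) rep \<Rightarrow> real vec set" where
  "stability_space n M = {v \<in> carrier_vec (n + 1). semistable n v M}"


section \<open>Thin modules\<close>

definition simple_module :: "nat \<Rightarrow> ('k::field, 'k) rep" where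
  "simple_module i =
     \<lparr>rscale = (*),
      rspace = (\<lambda>j. if j = i then UNIV else {0}),
      rmap = (\<lambda>e x. 0)\<rparr>"

text \<open>
  Whether the step of the walk between \<open>j\<close> and \<open>j + 1\<close> is the arrow \<open>\<beta>\<^sub>j\<close>, rather than the formal
  inverse of \<open>\<alpha>\<^sub>j\<close>.
\<close>

definition beta_step :: "nat \<Rightarrow> int \<Rightarrow> nat \<Rightarrow> bool" where
  "beta_step a \<eta> j \<longleftrightarrow> (\<eta> = 1 \<and> [j = a] (mod 2)) \<or> (\<eta> = -1 \<and> \<not> [j = a] (mod 2))"

definition string_module :: "nat \<Rightarrow> nat \<Rightarrow> int \<Rightarrow> ('k::field, 'k) rep" where
  "string_module a b \<eta> =
     \<lparr>rscale = (*),
      rspace = (\<lambda>j. if j \<in> {a..b} then UNIV else {0}),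
      rmap = (\<lambda>e x. case e of
          Beta j \<Rightarrow> if j \<in> {a..<b} \<and> beta_step a \<eta> j then x else 0
        | Alpha j \<Rightarrow> if j \<in> {a..<b} \<and> \<not> beta_step a \<eta> j then x else 0)\<rparr>"


section \<open>The path algebra is a ring\<close>

text \<open>
  \<open>Idl\<close> is the intersection of all ideals containing the given set, and being an ideal presupposes
  that the ambient structure is a ring; so \<open>ideal_I\<close> has its intended meaning by the following.
\<close>

lemma path_end_append:
  "path_end G q = fst p \<Longrightarrow> path_end G (fst q, snd q @ snd p) = path_end G p"
  by (cases p) (auto simp: path_end_def pre_digraph.awalk_verts_conv)

lemma path_mult_superset:
  assumes "finite A" "finite B" "Poly_Mapping.keys x \<subseteq> A" "Poly_Mapping.keys y \<subseteq> B"
  shows "path_mult G x y =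
     (\<Sum>p\<in>A. \<Sum>q\<in>B. if path_end G q = fst p
        then Poly_Mapping.single (fst q, snd q @ snd p) (Poly_Mapping.lookup x p * Poly_Mapping.lookup y q)
        else 0)"
proof -
  have "(\<Sum>q\<in>Poly_Mapping.keys y. if path_end G q = fst p
        then Poly_Mapping.single (fst q, snd q @ snd p) (Poly_Mapping.lookup x p * Poly_Mapping.lookup y q)
        else 0) = (\<Sum>q\<in>B. if path_end G q = fst p
        then Poly_Mapping.single (fst q, snd q @ snd p) (Poly_Mapping.lookup x p * Poly_Mapping.lookup y q)
        else 0)" for p
    by (rule sum.mono_neutral_left) (use assms in \<open>auto simp: in_keys_iff\<close>)
  then show ?thesis
    unfolding path_mult_def
    by simp (rule sum.mono_neutral_left, use assms in \<open>auto simp: in_keys_iff cong: if_cong\<close>)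
qed

lemma path_mult_add_left: "path_mult G (x + x') y = path_mult G x y + path_mult G x' y"
proof -
  let ?A = "Poly_Mapping.keys x \<union> Poly_Mapping.keys x'" and ?B = "Poly_Mapping.keys y"
  note * = path_mult_superset[of ?A ?B]
  show ?thesis
    using keys_add[of x x']
    by (simp add: * lookup_add sum.distrib[symmetric] ring_distribs single_add if_distrib cong: if_cong)
qed

lemma path_mult_add_right: "path_mult G x (y + y') = path_mult G x y + path_mult G x y'"
proof -
  let ?B = "Poly_Mapping.keys y \<union> Poly_Mapping.keys y'" and ?A = "Poly_Mapping.keys x"
  note * = path_mult_superset[of ?A ?B]
  show ?thesis
    using keys_add[of y y']
    by (simp add: * lookup_add sum.distrib[symmetric] ring_distribs single_add if_distrib cong: if_cong)
qed

lemma path_mult_0 [simp]: "path_mult G 0 y = 0" "path_mult G x 0 = 0"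
  by (simp_all add: path_mult_def)

lemma path_mult_sum_left: "path_mult G (sum f A) y = (\<Sum>i\<in>A. path_mult G (f i) y)"
  by (induction A rule: infinite_finite_induct) (simp_all add: path_mult_add_left)

lemma path_mult_sum_right: "path_mult G x (sum f A) = (\<Sum>i\<in>A. path_mult G x (f i))"
  by (induction A rule: infinite_finite_induct) (simp_all add: path_mult_add_right)

lemma path_mult_single:
  "path_mult G (Poly_Mapping.single p c) (Poly_Mapping.single q d) =
     (if path_end G q = fst p then Poly_Mapping.single (fst q, snd q @ snd p) (c * d) else 0)"
  by (subst path_mult_superset[of "{p}" "{q}"]) auto

lemma poly_mapping_sum_single:
  "x = (\<Sum>p\<in>Poly_Mapping.keys x. Poly_Mapping.single p (Poly_Mapping.lookup x p))"
  by (rule poly_mapping_eqI) (auto simp: lookup_sum lookup_single when_def in_keys_iff)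

lemma path_mult_assoc: "path_mult G (path_mult G x y) z = path_mult G x (path_mult G y z)"
proof -
  have induct: "P x" if single: "\<And>p c. P (Poly_Mapping.single p c)" and add: "\<And>x y. P x \<Longrightarrow> P y \<Longrightarrow> P (x + y)"
    for P and x :: "('a, 'b) path \<Rightarrow>\<^sub>0 'c"
  proof -
    have "P 0" using single[of undefined 0] by simp
    then have "P (\<Sum>p\<in>A. Poly_Mapping.single p (Poly_Mapping.lookup x p))" for A
      by (induction A rule: infinite_finite_induct) (auto intro: single add)
    then show ?thesis by (subst poly_mapping_sum_single)
  qed
  show ?thesis
  proof (induction x rule: induct)
    case (1 p c)
    show ?case
    proof (induction y rule: induct)
      case (1 q d)
      show ?case
      proof (induction z rule: induct)
        case (1 r e)
        show ?case by (auto simp: path_mult_single path_end_append mult.assoc)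
      qed (simp add: path_mult_add_right)
    qed (simp add: path_mult_add_right path_mult_add_left)
  qed (simp add: path_mult_add_left)
qed

lemma (in wf_digraph) pathsD:
  assumes "p \<in> paths G"
  shows "fst p \<in> verts G" "set (snd p) \<subseteq> arcs G" "path_end G p \<in> verts G"
  using assms unfolding paths_def path_end_def awalk_def by (auto intro!: awlast_in_verts)

lemma (in wf_digraph) paths_append:
  assumes "p \<in> paths G" "q \<in> paths G" "path_end G q = fst p"
  shows "(fst q, snd q @ snd p) \<in> paths G"
proof -
  have "awalk (fst q) (snd q @ snd p) (path_end G p)"
    using assms unfolding paths_def by (auto intro: awalk_appendI)
  then show ?thesis
    by (simp add: paths_def path_end_append[OF assms(3)])
qed

lemma keys_sum_subset:
  "(\<And>i. i \<in> A \<Longrightarrow> Poly_Mapping.keys (f i) \<subseteq> S) \<Longrightarrow> Poly_Mapping.keys (sum f A) \<subseteq> S"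
  using keys_sum[of f A] by blast

lemma (in wf_digraph) keys_path_mult:
  assumes "Poly_Mapping.keys x \<subseteq> paths G" "Poly_Mapping.keys y \<subseteq> paths G"
  shows "Poly_Mapping.keys (path_mult G x y) \<subseteq> paths G"
  unfolding path_mult_def
proof (intro keys_sum_subset)
  fix p q assume "p \<in> Poly_Mapping.keys x" "q \<in> Poly_Mapping.keys y"
  then have "p \<in> paths G" "q \<in> paths G"
    using assms by auto
  then show "Poly_Mapping.keys (if path_end G q = fst p
        then Poly_Mapping.single (fst q, snd q @ snd p) (Poly_Mapping.lookup x p * Poly_Mapping.lookup y q)
        else 0) \<subseteq> paths G"
    using paths_append[of p q] by simp
qed

lemma (in wf_digraph) trivial_path: "u \<in> verts G \<Longrightarrow> (u, []) \<in> paths G"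
  by (simp add: paths_def path_end_def awalk_def)

lemma path_end_trivial [simp]: "path_end G (u, []) = u"
  by (simp add: path_end_def pre_digraph.awalk_verts.simps)

lemma (in fin_digraph) path_algebra_ring: "ring (path_algebra G :: (('a, 'b) path \<Rightarrow>\<^sub>0 'k::field) ring)"
proof -
  have one_left: "path_mult G (\<Sum>u\<in>verts G. Poly_Mapping.single (u, []) 1) x = x"
    if "Poly_Mapping.keys x \<subseteq> paths G" for x :: "('a, 'b) path \<Rightarrow>\<^sub>0 'k"
  proof -
    have "path_mult G (\<Sum>u\<in>verts G. Poly_Mapping.single (u, []) 1) x =
      (\<Sum>q\<in>Poly_Mapping.keys x. \<Sum>u\<in>verts G. if path_end G q = u then Poly_Mapping.single q (Poly_Mapping.lookup x q) else 0)"
      apply (subst poly_mapping_sum_single[of x])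
      apply (simp only: path_mult_sum_left path_mult_sum_right path_mult_single)
      apply (simp cong: if_cong)
      done
    also have "\<dots> = (\<Sum>q\<in>Poly_Mapping.keys x. Poly_Mapping.single q (Poly_Mapping.lookup x q))"
      using that by (intro sum.cong refl) (auto dest!: pathsD(3) subsetD)
    finally show ?thesis by (simp only: poly_mapping_sum_single[symmetric])
  qed
  have one_right: "path_mult G x (\<Sum>u\<in>verts G. Poly_Mapping.single (u, []) 1) = x"
    if "Poly_Mapping.keys x \<subseteq> paths G" for x :: "('a, 'b) path \<Rightarrow>\<^sub>0 'k"
  proof -
    have "path_mult G x (\<Sum>u\<in>verts G. Poly_Mapping.single (u, []) 1) =
      (\<Sum>p\<in>Poly_Mapping.keys x. \<Sum>u\<in>verts G. if u = fst p then Poly_Mapping.single (u, snd p) (Poly_Mapping.lookup x p) else 0)"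
      apply (subst poly_mapping_sum_single[of x])
      apply (simp only: path_mult_sum_left path_mult_sum_right path_mult_single)
      apply (subst sum.swap)
      apply (simp cong: if_cong)
      done
    also have "\<dots> = (\<Sum>q\<in>Poly_Mapping.keys x. Poly_Mapping.single q (Poly_Mapping.lookup x q))"
      using that by (intro sum.cong refl) (auto dest!: pathsD(1) subsetD)
    finally show ?thesis by (simp only: poly_mapping_sum_single[symmetric])
  qed
  let ?R = "path_algebra G :: (('a, 'b) path \<Rightarrow>\<^sub>0 'k) ring"
  show "ring ?R"
  proof (rule ringI)
    show "abelian_group ?R"
    proof (rule abelian_groupI)
      fix x assume "x \<in> carrier ?R"
      then show "\<exists>y\<in>carrier ?R. y \<oplus>\<^bsub>?R\<^esub> x = \<zero>\<^bsub>?R\<^esub>"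
        by (intro bexI[of _ "- x"]) (simp_all add: path_algebra_def)
    next
      fix x y assume "x \<in> carrier ?R" "y \<in> carrier ?R"
      then show "x \<oplus>\<^bsub>?R\<^esub> y \<in> carrier ?R"
        using keys_add[of x y] by (auto simp: path_algebra_def)
    qed (simp_all add: path_algebra_def ac_simps)
    have "Poly_Mapping.keys (\<Sum>u\<in>verts G. Poly_Mapping.single (u, []) 1 :: ('a, 'b) path \<Rightarrow>\<^sub>0 'k) \<subseteq> paths G"
      by (rule keys_sum_subset) (simp add: trivial_path)
    then show "monoid ?R"
      by (intro monoidI) (simp_all add: path_algebra_def path_mult_assoc one_left one_right keys_path_mult)
  qed (simp_all add: path_algebra_def path_mult_add_left path_mult_add_right)
qed


section \<open>Representations bound by an ideal\<close>

lemma (in wf_digraph) fold_rmap: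
  assumes "is_rep G M" "awalk u p v"
  shows "x \<in> rspace M u \<Longrightarrow> fold (rmap M) p x \<in> rspace M v"
    and "x \<in> rspace M u \<Longrightarrow> y \<in> rspace M u \<Longrightarrow>
           fold (rmap M) p (x + y) = fold (rmap M) p x + fold (rmap M) p y"
    and "x \<in> rspace M u \<Longrightarrow> fold (rmap M) p (rscale M c x) = rscale M c (fold (rmap M) p x)"
  using assms(2)
proof (induction p arbitrary: u x y)
  case Nil
  {
    case 1
    then show ?case by (auto simp: awalk_def)
  next
    case 2
    then show ?case by simp
  next
    case 3
    then show ?case by simp
  }
next
  case (Cons e p)
  have *: "e \<in> arcs G" "tail G e = u" "awalk (head G e) p v" if "awalk u (e # p) v" for u
    using that by (auto simp: awalk_Cons_iff)
  have **: "rmap M e x \<in> rspace M (head G e)"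
    "rmap M e (rscale M c x) = rscale M c (rmap M e x)"
    "y \<in> rspace M u \<Longrightarrow> rmap M e (x + y) = rmap M e x + rmap M e y"
    if "awalk u (e # p) v" "x \<in> rspace M u" for u x y c
    using *[OF that(1)] that(2) assms(1) unfolding is_rep_def by blast+
  {
    case 1
    show ?case using Cons.IH(1)[OF **(1)[OF 1(2,1)] *(3)[OF 1(2)]] by simp
  next
    case 2
    show ?case
      using Cons.IH(2)[OF **(1)[OF 2(3,1)] **(1)[OF 2(3,2)] *(3)[OF 2(3)]] **(3)[OF 2(3,1,2)] by simp
  next
    case 3
    show ?case
      using Cons.IH(3)[OF **(1)[OF 3(2,1)] *(3)[OF 3(2)]] **(2)[OF 3(2,1)] by simp
  }
qed

lemma (in wf_digraph) fold_rmap_sum: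
  assumes "is_rep G M" "awalk u p v" "\<And>i. i \<in> A \<Longrightarrow> f i \<in> rspace M u" "finite A"
  shows "fold (rmap M) p (sum f A) = (\<Sum>i\<in>A. fold (rmap M) p (f i))"
proof -
  have vs: "vector_space (rscale M)" and u: "module.subspace (rscale M) (rspace M u)"
    using assms(1,2) by (auto simp: is_rep_def awalk_def)
  interpret vector_space "rscale M" by fact
  have 0: "fold (rmap M) p 0 = 0"
    using fold_rmap(3)[OF assms(1,2), of 0 0] subspace_0[OF u] by simp
  from assms(4,3) show ?thesis
    by (induction A)
       (auto simp: 0 fold_rmap(2)[OF assms(1,2)] subspace_sum[OF u])
qed

lemma rep_action_superset:
  assumes "vector_space (rscale M)" "finite A" "Poly_Mapping.keys x \<subseteq> A"
  shows "rep_action G M x u w m =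
    (\<Sum>p\<in>A. if fst p = u \<and> path_end G p = w
       then rscale M (Poly_Mapping.lookup x p) (fold (rmap M) (snd p) m) else 0)"
proof -
  interpret vector_space "rscale M" by fact
  have "rep_action G M x u w m = (\<Sum>p\<in>Poly_Mapping.keys x. if fst p = u \<and> path_end G p = w
       then rscale M (Poly_Mapping.lookup x p) (fold (rmap M) (snd p) m) else 0)"
    unfolding rep_action_def by (simp add: sum.If_cases Int_def)
  also have "\<dots> = (\<Sum>p\<in>A. if fst p = u \<and> path_end G p = w
       then rscale M (Poly_Mapping.lookup x p) (fold (rmap M) (snd p) m) else 0)"
    by (rule sum.mono_neutral_left) (use assms in \<open>auto simp: in_keys_iff\<close>)
  finally show ?thesis .
qed

lemma rep_action_add:
  assumes "vector_space (rscale M)"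
  shows "rep_action G M (x + y) u w m = rep_action G M x u w m + rep_action G M y u w m"
proof -
  interpret vector_space "rscale M" by fact
  note * = rep_action_superset[OF assms, of "Poly_Mapping.keys x \<union> Poly_Mapping.keys y"]
  show ?thesis
    using keys_add[of x y]
    by (simp add: * lookup_add scale_left_distrib sum.distrib[symmetric] if_distrib cong: if_cong)
qed

lemma rep_action_0 [simp]: "rep_action G M 0 u w m = 0"
  by (simp add: rep_action_def)

lemma rep_action_uminus:
  assumes "vector_space (rscale M)"
  shows "rep_action G M (- x) u w m = - rep_action G M x u w m"
  using rep_action_add[OF assms, of G "- x" x u w m] by (simp add: eq_neg_iff_add_eq_0)

lemma rep_action_diff:
  assumes "vector_space (rscale M)"
  shows "rep_action G M (x - y) u w m = rep_action G M x u w m - rep_action G M y u w m"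
  using rep_action_add[OF assms, of G x "- y" u w m] by (simp add: rep_action_uminus[OF assms])

lemma rep_action_sum:
  assumes "vector_space (rscale M)"
  shows "rep_action G M (sum f A) u w m = (\<Sum>i\<in>A. rep_action G M (f i) u w m)"
  by (induction A rule: infinite_finite_induct) (simp_all add: rep_action_add[OF assms])

lemma rep_action_single:
  assumes "vector_space (rscale M)"
  shows "rep_action G M (Poly_Mapping.single p c) u w m =
    (if fst p = u \<and> path_end G p = w then rscale M c (fold (rmap M) (snd p) m) else 0)"
  by (subst rep_action_superset[OF assms, of "{p}"]) auto

lemma rep_action_mult:
  assumes "vector_space (rscale M)"
  shows "rep_action G M (path_mult G x y) u w m =
    (\<Sum>p\<in>Poly_Mapping.keys x. \<Sum>q\<in>Poly_Mapping.keys y.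
       if fst q = u \<and> path_end G q = fst p \<and> path_end G p = w
       then rscale M (Poly_Mapping.lookup x p * Poly_Mapping.lookup y q)
              (fold (rmap M) (snd p) (fold (rmap M) (snd q) m))
       else 0)"
  unfolding path_mult_def rep_action_sum[OF assms]
proof (intro sum.cong refl)
  interpret vector_space "rscale M" by fact
  fix p q
  show "rep_action G M (if path_end G q = fst p
        then Poly_Mapping.single (fst q, snd q @ snd p) (Poly_Mapping.lookup x p * Poly_Mapping.lookup y q)
        else 0) u w m =
     (if fst q = u \<and> path_end G q = fst p \<and> path_end G p = w
       then rscale M (Poly_Mapping.lookup x p * Poly_Mapping.lookup y q)
              (fold (rmap M) (snd p) (fold (rmap M) (snd q) m))
       else 0)"
    by (cases "path_end G q = fst p")
       (simp_all add: rep_action_single[OF assms] path_end_append del: split_paired_All)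
qed

lemma (in wf_digraph) annihilates_mult_left:
  assumes "is_rep G M" "annihilates G y M"
    and x: "Poly_Mapping.keys x \<subseteq> paths G" and y: "Poly_Mapping.keys y \<subseteq> paths G"
  shows "annihilates G (path_mult G x y) M"
  unfolding annihilates_def
proof safe
  fix u w m assume u: "u \<in> verts G" and w: "w \<in> verts G" and m: "m \<in> rspace M u"
  have vs: "vector_space (rscale M)" using assms(1) by (auto simp: is_rep_def)
  interpret vector_space "rscale M" by fact
  have "(\<Sum>q\<in>Poly_Mapping.keys y. if fst q = u \<and> path_end G q = fst p \<and> path_end G p = w
       then rscale M (Poly_Mapping.lookup x p * Poly_Mapping.lookup y q)
              (fold (rmap M) (snd p) (fold (rmap M) (snd q) m)) else 0) = 0" (is "?l = 0")
    if "p \<in> Poly_Mapping.keys x" for p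
  proof (cases "path_end G p = w")
    case True
    have p: "awalk (fst p) (snd p) w" "fst p \<in> verts G"
      using that x True by (auto simp: paths_def dest: pathsD)
    let ?A = "{q \<in> Poly_Mapping.keys y. fst q = u \<and> path_end G q = fst p}"
    have in_space: "fold (rmap M) (snd q) m \<in> rspace M (fst p)" if "q \<in> ?A" for q
    proof -
      have "awalk u (snd q) (fst p)" using that y by (auto simp: paths_def)
      from fold_rmap(1)[OF assms(1) this m] show ?thesis .
    qed
    have sub: "module.subspace (rscale M) (rspace M (fst p))"
      using assms(1) p by (auto simp: is_rep_def)
    have "?l = (\<Sum>q\<in>?A. rscale M (Poly_Mapping.lookup x p * Poly_Mapping.lookup y q)
              (fold (rmap M) (snd p) (fold (rmap M) (snd q) m)))"
      using True by (simp add: sum.If_cases Int_def)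
    also have "\<dots> = (\<Sum>q\<in>?A. rscale M (Poly_Mapping.lookup x p)
              (fold (rmap M) (snd p) (rscale M (Poly_Mapping.lookup y q) (fold (rmap M) (snd q) m))))"
      by (intro sum.cong refl) (simp only: fold_rmap(3)[OF assms(1) p(1) in_space] scale_scale)
    also have "\<dots> = rscale M (Poly_Mapping.lookup x p) (fold (rmap M) (snd p) (rep_action G M y u (fst p) m))"
      unfolding rep_action_def
      by (subst fold_rmap_sum[OF assms(1) p(1)])
         (auto intro!: subspace_scale[OF sub] in_space simp: scale_sum_right)
    also have "rep_action G M y u (fst p) m = 0"
      using assms(2) u p m by (auto simp: annihilates_def)
    also have "fold (rmap M) (snd p) 0 = 0"
      using fold_rmap(3)[OF assms(1) p(1), of 0 0] subspace_0[OF sub] by simp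
    finally show ?thesis by simp
  qed simp
  then show "rep_action G M (path_mult G x y) u w m = 0"
    by (simp add: rep_action_mult[OF vs])
qed

lemma (in wf_digraph) annihilates_mult_right:
  assumes "is_rep G M" "annihilates G x M"
    and x: "Poly_Mapping.keys x \<subseteq> paths G" and y: "Poly_Mapping.keys y \<subseteq> paths G"
  shows "annihilates G (path_mult G x y) M"
  unfolding annihilates_def
proof safe
  fix u w m assume u: "u \<in> verts G" and w: "w \<in> verts G" and m: "m \<in> rspace M u"
  have vs: "vector_space (rscale M)" using assms(1) by (auto simp: is_rep_def)
  interpret vector_space "rscale M" by fact
  have "(\<Sum>p\<in>Poly_Mapping.keys x. if fst q = u \<and> path_end G q = fst p \<and> path_end G p = w
       then rscale M (Poly_Mapping.lookup x p * Poly_Mapping.lookup y q)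
              (fold (rmap M) (snd p) (fold (rmap M) (snd q) m)) else 0) = 0" (is "?l = 0")
    if "q \<in> Poly_Mapping.keys y" for q
  proof (cases "fst q = u")
    case True
    have q: "awalk u (snd q) (path_end G q)" "path_end G q \<in> verts G"
      using that y True by (auto simp: paths_def dest: pathsD)
    have "?l = (\<Sum>p\<in>{p \<in> Poly_Mapping.keys x. fst p = path_end G q \<and> path_end G p = w}.
       rscale M (Poly_Mapping.lookup x p * Poly_Mapping.lookup y q)
              (fold (rmap M) (snd p) (fold (rmap M) (snd q) m)))"
      using True by (simp add: sum.If_cases Int_def eq_commute)
    also have "\<dots> = rscale M (Poly_Mapping.lookup y q)
        (rep_action G M x (path_end G q) w (fold (rmap M) (snd q) m))"
      unfolding rep_action_def by (simp add: scale_sum_right mult.commute)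
    also have "rep_action G M x (path_end G q) w (fold (rmap M) (snd q) m) = 0"
      using assms(2) q w fold_rmap(1)[OF assms(1) q(1) m] by (auto simp: annihilates_def)
    finally show ?thesis by simp
  qed simp
  then show "rep_action G M (path_mult G x y) u w m = 0"
    by (subst rep_action_mult[OF vs], subst sum.swap) simp
qed

lemma (in fin_digraph) annihilates_genideal_iff:
  fixes M :: "('a, 'b, 'k::field, 'v::ab_group_add) quiver_rep"
  assumes "is_rep G M" "\<And>x. x \<in> R \<Longrightarrow> Poly_Mapping.keys x \<subseteq> paths G"
  shows "(\<forall>x\<in>Idl\<^bsub>path_algebra G\<^esub> R. annihilates G x M) \<longleftrightarrow> (\<forall>x\<in>R. annihilates G x M)"
proof
  assume *: "\<forall>x\<in>Idl\<^bsub>path_algebra G\<^esub> R. annihilates G x M"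
  have "R \<subseteq> Idl\<^bsub>path_algebra G\<^esub> R" by (auto simp: genideal_def)
  with * show "\<forall>x\<in>R. annihilates G x M" by blast
next
  assume R: "\<forall>x\<in>R. annihilates G x M"
  have vs: "vector_space (rscale M)" using assms(1) by (auto simp: is_rep_def)
  let ?R = "path_algebra G :: (('a, 'b) path \<Rightarrow>\<^sub>0 'k) ring"
  interpret ring ?R by (rule path_algebra_ring)
  let ?K = "{x \<in> carrier ?R. annihilates G x M}"
  have "ideal ?K ?R"
  proof (rule idealI)
    show "subgroup ?K (add_monoid ?R)"
    proof (rule group.subgroupI)
      show "group (add_monoid ?R)" by (rule a_group)
      fix x assume x: "x \<in> ?K"
      have "\<ominus>\<^bsub>?R\<^esub> x = - x"
        using x by (intro minus_equality) (auto simp: path_algebra_def)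
      then have "inv\<^bsub>add_monoid ?R\<^esub> x = - x"
        by (simp only: a_inv_def)
      then show "inv\<^bsub>add_monoid ?R\<^esub> x \<in> ?K"
        using x by (simp add: path_algebra_def annihilates_def rep_action_uminus[OF vs])
    next
      fix x y assume "x \<in> ?K" "y \<in> ?K"
      then show "x \<otimes>\<^bsub>add_monoid ?R\<^esub> y \<in> ?K"
        using keys_add[of x y] by (auto simp: path_algebra_def annihilates_def rep_action_add[OF vs])
    next
      have "0 \<in> ?K" by (auto simp: path_algebra_def annihilates_def)
      then show "?K \<noteq> {}" by blast
    qed auto
  next
    fix a x assume *: "a \<in> ?K" "x \<in> carrier ?R"
    then show "x \<otimes>\<^bsub>?R\<^esub> a \<in> ?K"
      using annihilates_mult_left[OF assms(1), of a x] keys_path_mult[of x a]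
      by (simp add: path_algebra_def)
    from * show "a \<otimes>\<^bsub>?R\<^esub> x \<in> ?K"
      using annihilates_mult_right[OF assms(1), of a x] keys_path_mult[of a x]
      by (simp add: path_algebra_def)
  qed (rule ring_axioms)
  moreover have "R \<subseteq> ?K"
    using R assms(2) by (auto simp: path_algebra_def)
  ultimately have "Idl\<^bsub>?R\<^esub> R \<subseteq> ?K" by (rule genideal_minimal)
  then show "\<forall>x\<in>Idl\<^bsub>?R\<^esub> R. annihilates G x M" by blast
qed


section \<open>Modules over \<open>B(n)\<close>\<close>

lemma quiver_Q_simps:
  "verts (quiver_Q n) = {0..n}"
  "arcs (quiver_Q n) = Alpha ` {0..<n} \<union> Beta ` {0..<n}"
  "tail (quiver_Q n) (Alpha i) = i + 1" "head (quiver_Q n) (Alpha i) = i"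
  "tail (quiver_Q n) (Beta i) = i" "head (quiver_Q n) (Beta i) = i + 1"
  by (simp_all add: quiver_Q_def)

lemma fin_digraph_quiver_Q: "fin_digraph (quiver_Q n)"
  by unfold_locales (auto simp: quiver_Q_def)

lemma path_end_quiver_Q:
  "path_end (quiver_Q n) (u, [e]) = head (quiver_Q n) e"
  "path_end (quiver_Q n) (u, [e, e']) = head (quiver_Q n) e'"
  by (simp_all add: path_end_def pre_digraph.awalk_verts.simps)

lemma relations_eq:
  "relations n =
     {Poly_Mapping.single (i + 1, [Alpha i, Beta i]) 1 - Poly_Mapping.single (i + 1, [Beta (i + 1), Alpha (i + 1)]) 1 | i. i + 2 \<le> n} \<union>
     {Poly_Mapping.single (i + 2, [Alpha (i + 1), Alpha i]) 1 | i. i + 2 \<le> n} \<union>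
     {Poly_Mapping.single (i, [Beta i, Beta (i + 1)]) 1 | i. i + 2 \<le> n} \<union>
     {Poly_Mapping.single (0, [Beta 0, Alpha 0]) (1 :: 'k::field)}"
  by (simp add: relations_def Let_def arrow_def path_mult_single path_end_quiver_Q)
     (simp add: quiver_Q_def)

lemma keys_relations:
  assumes "n \<ge> 1" "x \<in> relations n"
  shows "Poly_Mapping.keys x \<subseteq> paths (quiver_Q n)"
proof -
  interpret fin_digraph "quiver_Q n" by (rule fin_digraph_quiver_Q)
  have *: "(i + 1, [Alpha i, Beta i]) \<in> paths (quiver_Q n)"
    "(i + 1, [Beta (i + 1), Alpha (i + 1)]) \<in> paths (quiver_Q n)"
    "(i + 2, [Alpha (i + 1), Alpha i]) \<in> paths (quiver_Q n)"
    "(i, [Beta i, Beta (i + 1)]) \<in> paths (quiver_Q n)" if "i + 2 \<le> n" for i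
    using that by (auto simp: paths_def awalk_def path_end_quiver_Q quiver_Q_simps)
  have "(0, [Beta 0, Alpha 0]) \<in> paths (quiver_Q n)"
    using assms(1) by (auto simp: paths_def awalk_def path_end_quiver_Q quiver_Q_simps)
  with * assms(2) show ?thesis
    unfolding relations_eq
    by (auto split: if_splits dest!: keys_diff[THEN subsetD])
qed

lemma B_module_iff:
  assumes "n \<ge> 1"
  shows "B_module n M \<longleftrightarrow>
    is_rep (quiver_Q n) M \<and>
    (\<forall>i. i + 2 \<le> n \<longrightarrow>
       (\<forall>m\<in>rspace M (i + 1).
          rmap M (Beta i) (rmap M (Alpha i) m) = rmap M (Alpha (i + 1)) (rmap M (Beta (i + 1)) m)) \<and>
       (\<forall>m\<in>rspace M (i + 2). rmap M (Alpha i) (rmap M (Alpha (i + 1)) m) = 0) \<and>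
       (\<forall>m\<in>rspace M i. rmap M (Beta (i + 1)) (rmap M (Beta i) m) = 0)) \<and>
    (\<forall>m\<in>rspace M 0. rmap M (Alpha 0) (rmap M (Beta 0) m) = 0)"
proof (cases "is_rep (quiver_Q n) M")
  case True
  then have vs: "vector_space (rscale M)" by (auto simp: is_rep_def)
  interpret vector_space "rscale M" by fact
  have "B_module n M \<longleftrightarrow> (\<forall>x\<in>relations n. annihilates (quiver_Q n) x M)"
    unfolding B_module_def ideal_I_def
    using fin_digraph.annihilates_genideal_iff[OF fin_digraph_quiver_Q True, of "relations n"]
      keys_relations[OF assms] True by auto
  also have "\<dots> \<longleftrightarrow>
    (\<forall>i. i + 2 \<le> n \<longrightarrow>
       (\<forall>m\<in>rspace M (i + 1).
          rmap M (Beta i) (rmap M (Alpha i) m) = rmap M (Alpha (i + 1)) (rmap M (Beta (i + 1)) m)) \<and>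
       (\<forall>m\<in>rspace M (i + 2). rmap M (Alpha i) (rmap M (Alpha (i + 1)) m) = 0) \<and>
       (\<forall>m\<in>rspace M i. rmap M (Beta (i + 1)) (rmap M (Beta i) m) = 0)) \<and>
    (\<forall>m\<in>rspace M 0. rmap M (Alpha 0) (rmap M (Beta 0) m) = 0)"
  proof -
    have single: "annihilates (quiver_Q n) (Poly_Mapping.single (u, [e, e']) 1) M \<longleftrightarrow>
        (\<forall>m\<in>rspace M u. rmap M e' (rmap M e m) = 0)"
      if "u \<in> verts (quiver_Q n)" "head (quiver_Q n) e' \<in> verts (quiver_Q n)" for u e e'
      using that by (auto simp: annihilates_def rep_action_single[OF vs] path_end_quiver_Q)
    have diff: "annihilates (quiver_Q n)
          (Poly_Mapping.single (u, [e, e']) 1 - Poly_Mapping.single (u, [f, f']) 1) M \<longleftrightarrow>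
        (\<forall>m\<in>rspace M u. rmap M e' (rmap M e m) = rmap M f' (rmap M f m))"
      if "u \<in> verts (quiver_Q n)" "head (quiver_Q n) e' \<in> verts (quiver_Q n)"
        "head (quiver_Q n) e' = head (quiver_Q n) f'" for u e e' f f'
      using that by (auto simp: annihilates_def rep_action_diff[OF vs] rep_action_single[OF vs] path_end_quiver_Q)
    have v: "verts (quiver_Q n) = {0..n}" "head (quiver_Q n) (Alpha i) = i" "head (quiver_Q n) (Beta i) = i + 1" for i
      by (simp_all add: quiver_Q_def)
    have sets: "(\<forall>x \<in> {f i | i. P i} \<union> {g i | i. P i} \<union> {h i | i. P i} \<union> {c}. R x) \<longleftrightarrow>
        (\<forall>i. P i \<longrightarrow> R (f i) \<and> R (g i) \<and> R (h i)) \<and> R c" for f g h c and P :: "nat \<Rightarrow> bool" and R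
      by blast
    show ?thesis
      unfolding relations_eq sets
      by (intro conj_cong all_cong) (simp_all add: single diff v)
  qed
  finally show ?thesis using True by simp
qed (simp add: B_module_def)

lemma vector_space_mult: "vector_space ((*) :: 'k::field \<Rightarrow> 'k \<Rightarrow> 'k)"
  by unfold_locales (auto simp: algebra_simps)

lemma finite_span_mult:
  "\<exists>B. finite B \<and> module.span ((*) :: 'k::field \<Rightarrow> 'k \<Rightarrow> 'k) B = UNIV"
  "\<exists>B. finite B \<and> module.span ((*) :: 'k::field \<Rightarrow> 'k \<Rightarrow> 'k) B = {0}"
proof -
  interpret vector_space "(*) :: 'k::field \<Rightarrow> 'k \<Rightarrow> 'k" by (rule vector_space_mult)
  have "span {1} = (UNIV :: 'k set)" by (auto simp: span_singleton)
  then show "\<exists>B. finite B \<and> span B = (UNIV :: 'k set)" by blast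
  show "\<exists>B. finite B \<and> span B = ({0} :: 'k set)" by (intro exI[of _ "{}"]) simp
qed

lemma subspace_mult:
  "module.subspace ((*) :: 'k::field \<Rightarrow> 'k \<Rightarrow> 'k) UNIV"
  "module.subspace ((*) :: 'k::field \<Rightarrow> 'k \<Rightarrow> 'k) {0}"
proof -
  interpret vector_space "(*) :: 'k::field \<Rightarrow> 'k \<Rightarrow> 'k" by (rule vector_space_mult)
  show "subspace (UNIV :: 'k set)" "subspace ({0} :: 'k set)" by simp_all
qed

lemma UNIV_neq_0: "(UNIV :: 'k::field set) \<noteq> {0}"
  by (metis UNIV_I singletonD zero_neq_one)

lemma B_module_simple:
  assumes "n \<ge> 1" "i \<le> n"
  shows "B_module n (simple_module i)" "nonzero_module n (simple_module i)"
  using assms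
  by (auto simp: B_module_iff is_rep_def simple_module_def nonzero_module_def quiver_Q_def
      vector_space_mult finite_span_mult subspace_mult UNIV_neq_0)

lemma B_module_string:
  assumes "n \<ge> 1" "a < b" "b \<le> n" "\<eta> \<in> {1, -1}"
  shows "B_module n (string_module a b \<eta> :: ('k::field, 'k) rep)"
    "nonzero_module n (string_module a b \<eta> :: ('k, 'k) rep)"
proof -
  have alt: "beta_step a \<eta> (Suc j) \<longleftrightarrow> \<not> beta_step a \<eta> j" for j
  proof -
    have "Suc j mod 2 = a mod 2 \<longleftrightarrow> j mod 2 \<noteq> a mod 2" by presburger
    with assms(4) show ?thesis by (auto simp: beta_step_def cong_def)
  qed
  let ?M = "string_module a b \<eta> :: ('k, 'k) rep"
  have M: "rscale ?M = (*)" "rspace ?M j = (if j \<in> {a..b} then UNIV else {0})"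
    "rmap ?M (Beta j) x = (if j \<in> {a..<b} \<and> beta_step a \<eta> j then x else 0)"
    "rmap ?M (Alpha j) x = (if j \<in> {a..<b} \<and> \<not> beta_step a \<eta> j then x else 0)" for j x
    by (simp_all add: string_module_def)
  have arc: "rmap ?M e x \<in> rspace ?M (head (quiver_Q n) e) \<and>
      (\<forall>y. rmap ?M e (x + y) = rmap ?M e x + rmap ?M e y) \<and> (\<forall>c. rmap ?M e (c * x) = c * rmap ?M e x)"
    for e x
    by (cases e) (auto simp: M quiver_Q_simps)
  have "is_rep (quiver_Q n) ?M"
    unfolding is_rep_def
    using arc by (simp add: M(1,2) vector_space_mult finite_span_mult subspace_mult)
  then show "B_module n ?M"
    using assms(1) alt by (simp add: B_module_iff M)
  show "nonzero_module n ?M"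
    using assms(2,3) by (auto simp: nonzero_module_def string_module_def quiver_Q_def UNIV_neq_0 intro!: bexI[of _ a])
qed

end

theory Submission
  imports Defs
begin

text \<open>
  A thin module is a module with at most one-dimensional spaces at the vertices, so a submodule is
  the same as a set \<open>S\<close> of vertices of the support, namely one that no arrow acting nontrivially
  leaves. Its pairing with \<open>v\<close> is the sum of \<open>v\<close> over \<open>S\<close>, and semistability becomes the
  condition that the sum over the support is zero and the sum over every such \<open>S\<close> is at most
  zero (\<open>semistable_thin_iff\<close>). For a simple module only \<open>S = {}\<close> and the whole support occur.

  For a string module on \<open>[a, b]\<close> the nonzero arrows alternate, so every vertex of the support is
  either a source or a sink. If \<open>\<eta> = -1\<close>, the sinks are the vertices of the parity of \<open>a\<close>, and
  \<open>S\<close> is a submodule iff it contains with every source also the neighbours of that source.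
  The connected components of such a set are again of this kind, and an interval is of this kind iff
  its left end is a sink and its right end is a sink or \<open>b\<close>. (The left end \<open>a\<close> of the support is a
  sink itself, which explains why the two ends enter the theorem differently.) Since sums over \<open>S\<close>
  are sums over its components, it suffices to test intervals (\<open>sum_nonpos_iff_intervals\<close>).

  If \<open>\<eta> = 1\<close>, all arrows are reversed, and the submodules are the complements in \<open>[a, b]\<close> of the
  sets above. As \<open>v\<close> sums to zero over \<open>[a, b]\<close>, passing to the complement changes the sign, which
  turns \<open>\<le>\<close> into \<open>\<ge>\<close>.
\<close>

section \<open>Submodules of thin modules\<close>

lemma subspace_mult_cases:
  assumes "module.subspace ((*) :: 'k::field \<Rightarrow> 'k \<Rightarrow> 'k) V"
  shows "V = {0} \<or> V = UNIV"
proof -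
  interpret vector_space "(*) :: 'k \<Rightarrow> 'k \<Rightarrow> 'k" by (rule vector_space_mult)
  have "y \<in> V" if "x \<in> V" "x \<noteq> 0" for x y
    using subspace_scale[OF assms that(1), of "y / x"] that(2) by simp
  moreover have "0 \<in> V" by (rule subspace_0[OF assms])
  ultimately show ?thesis by blast
qed

lemma dim_mult:
  "vector_space.dim ((*) :: 'k::field \<Rightarrow> 'k \<Rightarrow> 'k) UNIV = 1"
  "vector_space.dim ((*) :: 'k::field \<Rightarrow> 'k \<Rightarrow> 'k) {0} = 0"
proof -
  interpret vector_space "(*) :: 'k \<Rightarrow> 'k \<Rightarrow> 'k" by (rule vector_space_mult)
  have "span {1} = (UNIV :: 'k set)" by (auto simp: span_singleton)
  then show "dim (UNIV :: 'k set) = 1"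
    using dim_unique[of "{1}" UNIV 1] by simp
  show "dim ({0} :: 'k set) = 0"
    using dim_unique[of "{}" "{0}" 0] independent_empty by simp
qed

definition thin_on :: "nat set \<Rightarrow> ('k::field, 'k) rep \<Rightarrow> bool" where
  "thin_on S M \<longleftrightarrow> rscale M = (*) \<and> (\<forall>j. rspace M j = (if j \<in> S then UNIV else {0}))"

definition closed_under_arrows :: "nat \<Rightarrow> ('k::field, 'k) rep \<Rightarrow> nat set \<Rightarrow> bool" where
  "closed_under_arrows n M S \<longleftrightarrow>
     (\<forall>e\<in>arcs (quiver_Q n). tail (quiver_Q n) e \<in> S \<and> head (quiver_Q n) e \<notin> S \<longrightarrow>
        (\<forall>x. rmap M e x = 0))"

lemma scalar_prod_dim_vector:
  fixes M :: "('k::field, 'k) rep"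
  assumes "rscale M = (*)" "\<And>j. j \<le> n \<Longrightarrow> rspace M j = (if j \<in> S then UNIV else {0})"
    "S \<subseteq> {0..n}"
  shows "v \<bullet> dim_vector n M = (\<Sum>j\<in>S. v $ j)"
proof -
  have "v \<bullet> dim_vector n M = (\<Sum>j\<in>{0..n}. if j \<in> S then v $ j else 0)"
    unfolding scalar_prod_def dim_vector_def
    by (intro sum.cong) (auto simp: assms(1,2) dim_mult)
  also have "\<dots> = (\<Sum>j\<in>S. v $ j)"
    using assms(3) by (simp add: sum.If_cases Int_absorb1)
  finally show ?thesis .
qed

text \<open>
  The spaces of a submodule lie between zero and a line, so the submodule is determined by the set of
  vertices where it is nonzero.
\<close>

lemma submodule_thinE:
  fixes M N :: "('k::field, 'k) rep"
  assumes "thin_on I M" "I \<subseteq> {0..n}" "submodule n N M"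
  obtains S where "S \<subseteq> I" "closed_under_arrows n M S"
    "\<And>j. j \<le> n \<Longrightarrow> rspace N j = (if j \<in> S then UNIV else {0})"
proof
  let ?S = "{j \<in> {0..n}. rspace N j \<noteq> {0}}"
  have N: "is_rep (quiver_Q n) N" "rscale N = (*)"
    "\<And>j. j \<le> n \<Longrightarrow> rspace N j \<subseteq> rspace M j"
    "\<And>e x. e \<in> arcs (quiver_Q n) \<Longrightarrow> x \<in> rspace N (tail (quiver_Q n) e) \<Longrightarrow> rmap N e x = rmap M e x"
    using assms by (auto simp: submodule_def thin_on_def B_module_def quiver_Q_simps)
  show spaces: "rspace N j = (if j \<in> ?S then UNIV else {0})" if "j \<le> n" for j
  proof -
    have "module.subspace (*) (rspace N j)"
      using N(1,2) that by (auto simp: is_rep_def quiver_Q_simps)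
    then show ?thesis
      using subspace_mult_cases[of "rspace N j"] that by auto
  qed
  show "?S \<subseteq> I"
  proof
    fix j assume j: "j \<in> ?S"
    then have "rspace M j \<noteq> {0}"
      using spaces[of j] N(3)[of j] UNIV_neq_0 by auto
    then show "j \<in> I"
      using assms(1) by (auto simp: thin_on_def split: if_splits)
  qed
  show "closed_under_arrows n M ?S"
    unfolding closed_under_arrows_def
  proof (intro ballI impI allI)
    fix e x
    assume e: "e \<in> arcs (quiver_Q n)"
      and S: "tail (quiver_Q n) e \<in> ?S \<and> head (quiver_Q n) e \<notin> ?S"
    have ends: "tail (quiver_Q n) e \<le> n" "head (quiver_Q n) e \<le> n"
      using e by (auto simp: quiver_Q_simps)
    have "rspace N (tail (quiver_Q n) e) = UNIV" "rspace N (head (quiver_Q n) e) = {0}"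
      using S by (simp_all only: ends[THEN spaces] if_True if_False simp_thms)
    moreover have "rmap N e x \<in> rspace N (head (quiver_Q n) e)"
      using N(1) e calculation(1) by (auto simp: is_rep_def)
    ultimately show "rmap M e x = 0"
      using N(4)[OF e, of x] by simp
  qed
qed

lemma submodule_restriction:
  fixes M :: "('k::field, 'k) rep"
  assumes "n \<ge> 1" "B_module n M" "thin_on I M" "S \<subseteq> I" "closed_under_arrows n M S"
  shows "submodule n (M\<lparr>rspace := \<lambda>j. if j \<in> S then UNIV else {0}\<rparr>) M"
proof -
  let ?N = "M\<lparr>rspace := \<lambda>j. if j \<in> S then UNIV else {0}\<rparr>"
  have M: "is_rep (quiver_Q n) M" "rscale M = (*)"
    "rspace M j = (if j \<in> I then UNIV else {0})" for j
    using assms(2,3) by (auto simp: B_module_def thin_on_def)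
  have sub: "rspace ?N j \<subseteq> rspace M j" for j
    using assms(4) by (auto simp: M(3))
  have linear: "rmap M e (x + y) = rmap M e x + rmap M e y" "rmap M e (c * x) = c * rmap M e x"
    if "e \<in> arcs (quiver_Q n)" "x \<in> rspace ?N (tail (quiver_Q n) e)"
      "y \<in> rspace ?N (tail (quiver_Q n) e)" for e x y c
    using M(1) that sub[of "tail (quiver_Q n) e"] unfolding is_rep_def M(2) by blast+
  have maps: "rmap M e x \<in> rspace ?N (head (quiver_Q n) e)"
    if "e \<in> arcs (quiver_Q n)" "x \<in> rspace ?N (tail (quiver_Q n) e)" for e x
  proof (cases "tail (quiver_Q n) e \<in> S")
    case True
    then show ?thesis
      using assms(5) that(1) by (auto simp: closed_under_arrows_def)
  next
    case False
    then have "x = 0" using that(2) by simp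
    then show ?thesis
      using linear(2)[OF that(1), of 0 0 0] by simp
  qed
  have "is_rep (quiver_Q n) ?N"
    unfolding is_rep_def
  proof (intro conjI ballI allI)
    fix u
    show "module.subspace (rscale ?N) (rspace ?N u)"
      "\<exists>B. finite B \<and> module.span (rscale ?N) B = rspace ?N u"
      by (simp_all add: M(2) subspace_mult finite_span_mult)
  qed (use maps linear in \<open>simp_all add: M(2) vector_space_mult\<close>)
  moreover have "\<And>j m. m \<in> rspace ?N j \<Longrightarrow> m \<in> rspace M j"
    using sub by blast
  moreover have "rmap ?N = rmap M" by simp
  ultimately have "B_module n ?N"
    using assms(2) unfolding B_module_iff[OF assms(1)] by (simp only:) blast
  then show ?thesis
    unfolding submodule_def using sub by simp
qed

text \<open>
  The sets \<open>S = {}\<close> and \<open>S = I\<close> belong to the submodules that semistability excludes from its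
  inequalities; they may be included because both sums vanish.
\<close>

lemma semistable_thin_iff:
  fixes M :: "('k::field, 'k) rep"
  assumes "n \<ge> 1" "B_module n M" "thin_on I M" "I \<subseteq> {0..n}"
  shows "semistable n v M \<longleftrightarrow>
    (\<Sum>j\<in>I. v $ j) = 0 \<and>
    (\<forall>S. S \<subseteq> I \<and> closed_under_arrows n M S \<longrightarrow> (\<Sum>j\<in>S. v $ j) \<le> 0)"
proof -
  have M: "rscale M = (*)" "rspace M j = (if j \<in> I then UNIV else {0})" for j
    using assms(3) by (auto simp: thin_on_def)
  have sum_I: "v \<bullet> dim_vector n M = (\<Sum>j\<in>I. v $ j)"
    by (rule scalar_prod_dim_vector[OF M assms(4)])
  show ?thesis
  proof (intro iffI conjI allI impI)
    assume ss: "semistable n v M"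
    then show *: "(\<Sum>j\<in>I. v $ j) = 0"
      by (simp add: semistable_def sum_I)
    fix S assume S: "S \<subseteq> I \<and> closed_under_arrows n M S"
    let ?N = "M\<lparr>rspace := \<lambda>j. if j \<in> S then UNIV else {0}\<rparr>"
    have sub: "submodule n ?N M"
      using submodule_restriction[OF assms(1-3)] S by blast
    have sum_S: "v \<bullet> dim_vector n ?N = (\<Sum>j\<in>S. v $ j)"
      by (rule scalar_prod_dim_vector) (use S assms(4) M(1) in auto)
    consider "S = {}" | "S = I" | i j where "i \<in> S" "j \<in> I" "j \<notin> S"
      using S by blast
    then show "(\<Sum>j\<in>S. v $ j) \<le> 0"
    proof cases
      case 3
      have "nonzero_module n ?N"
        unfolding nonzero_module_def
        using 3(1) S assms(4) UNIV_neq_0 by (intro bexI[of _ i]) (auto simp: quiver_Q_simps)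
      moreover have "proper_submodule n ?N M"
        unfolding proper_submodule_def
        using sub 3(2,3) assms(4) UNIV_neq_0 by (auto simp: quiver_Q_simps M(2) intro!: bexI[of _ j])
      ultimately show ?thesis
        using ss unfolding semistable_def sum_S[symmetric] by blast
    qed (use * in auto)
  next
    assume *: "(\<Sum>j\<in>I. v $ j) = 0 \<and>
      (\<forall>S. S \<subseteq> I \<and> closed_under_arrows n M S \<longrightarrow> (\<Sum>j\<in>S. v $ j) \<le> 0)"
    have "v \<bullet> dim_vector n N \<le> 0" if sub: "submodule n N M" for N
    proof -
      obtain S where S: "S \<subseteq> I" "closed_under_arrows n M S"
        "\<And>j. j \<le> n \<Longrightarrow> rspace N j = (if j \<in> S then UNIV else {0})"
        using submodule_thinE[OF assms(3,4) sub] by blast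
      have "rscale N = (*)"
        using sub M(1) by (simp add: submodule_def)
      then have "v \<bullet> dim_vector n N = (\<Sum>j\<in>S. v $ j)"
        by (rule scalar_prod_dim_vector) (use S assms(4) in auto)
      then show ?thesis
        using * S by simp
    qed
    with * assms(2) show "semistable n v M"
      by (auto simp: semistable_def proper_submodule_def sum_I)
  qed
qed


section \<open>Sets that contain the neighbours of their sources\<close>

text \<open>
  The submodules of the string module with \<open>\<eta> = -1\<close>: the vertices of the parity of \<open>a\<close> are sinks,
  the others are sources. The condition on a source is split according to the edge that leads to
  the neighbour, because this is how the arrows of the module are indexed.
\<close>

definition source_closed :: "nat \<Rightarrow> nat \<Rightarrow> nat set \<Rightarrow> bool" where
  "source_closed a b S \<longleftrightarrow>
     (\<forall>j\<in>{a..<b}. if [j = a] (mod 2) then j + 1 \<in> S \<longrightarrow> j \<in> S else j \<in> S \<longrightarrow> j + 1 \<in> S)"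

lemma cong_2_Suc: "[Suc j = a] (mod 2) \<longleftrightarrow> \<not> [j = a] (mod 2)" for j a :: nat
  by (simp add: cong_def mod2_eq_if)

lemma source_closed_interval:
  assumes "[a' = a] (mod 2)" "b' = b \<or> [b' = a] (mod 2)"
  shows "source_closed a b {a'..b'}"
proof -
  have "j \<noteq> a' - 1 \<or> a' = 0" if "[j = a] (mod 2)" for j
    using that assms(1) cong_2_Suc[of "a' - 1" a] by (cases a') auto
  then have "a' \<le> j" if "[j = a] (mod 2)" "a' \<le> j + 1" for j
    using that by fastforce
  moreover have "j + 1 \<le> b'" if "j < b" "\<not> [j = a] (mod 2)" "j \<le> b'" for j
    using that assms(2) by (cases "j = b'") auto
  ultimately show ?thesis
    unfolding source_closed_def by auto
qed

text \<open>
  Induction over the connected components: the first one is an interval of the tested form, and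
  removing it keeps the set source-closed because the vertex after it is missing.
\<close>

lemma sum_nonpos_if_source_closed:
  fixes f :: "nat \<Rightarrow> real"
  assumes intervals: "\<And>a' b'. a \<le> a' \<Longrightarrow> a' \<le> b' \<Longrightarrow> b' \<le> b \<Longrightarrow> [a' = a] (mod 2) \<Longrightarrow>
      b' = b \<or> [b' = a] (mod 2) \<Longrightarrow> sum f {a'..b'} \<le> 0"
    and "S \<subseteq> {a..b}" "source_closed a b S"
  shows "sum f S \<le> 0"
  using assms(2,3)
proof (induction "card S" arbitrary: S rule: less_induct)
  case less
  have fin: "finite S" using less.prems(1) by (rule finite_subset) simp
  show ?case
  proof (cases "S = {}")
    case False
    define a' where "a' = Min S"
    have a': "a' \<in> S" "\<And>j. j \<in> S \<Longrightarrow> a' \<le> j"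
      using False fin by (auto simp: a'_def)
    have "a \<le> a'" "a' \<le> b" using a'(1) less.prems(1) by auto
    have parity_a': "[a' = a] (mod 2)"
    proof (rule ccontr)
      assume odd: "\<not> [a' = a] (mod 2)"
      then have "a' \<noteq> a" by (auto simp: cong_def)
      then obtain j where j: "a' = Suc j" "a \<le> j"
        using \<open>a \<le> a'\<close> by (cases a') auto
      then have "j \<in> S"
        using less.prems(2) a'(1) odd \<open>a' \<le> b\<close> cong_2_Suc[of j a] by (auto simp: source_closed_def)
      with a'(2)[of j] j show False by simp
    qed
    \<comment> \<open>\<open>C\<close> consists of the right ends of initial pieces of the component of \<open>a'\<close>, so \<open>Max C\<close> is its
      right end.\<close>
    define C where "C = {k. {a'..k} \<subseteq> S \<and> a' \<le> k}"
    have "C \<subseteq> S" by (auto simp: C_def)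
    then have "finite C" using fin by (rule finite_subset)
    moreover have "C \<noteq> {}" using a'(1) by (auto simp: C_def intro!: exI[of _ a'])
    moreover define b' where "b' = Max C"
    ultimately have "b' \<in> C" "\<And>k. k \<in> C \<Longrightarrow> k \<le> b'"
      using Max_in[of C] Max_ge[of C] by auto
    then have b': "{a'..b'} \<subseteq> S" "a' \<le> b'" and maximal: "Suc b' \<notin> S"
    proof -
      show "{a'..b'} \<subseteq> S" "a' \<le> b'" using \<open>b' \<in> C\<close> by (auto simp: C_def)
      then show "Suc b' \<notin> S"
        using \<open>\<And>k. k \<in> C \<Longrightarrow> k \<le> b'\<close>[of "Suc b'"] by (auto simp: C_def atLeastAtMostSuc_conv)
    qed
    have "b' \<in> S" using b' by auto
    then have "b' \<le> b" using less.prems(1) by auto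
    have "b' = b \<or> [b' = a] (mod 2)"
    proof (rule ccontr)
      assume "\<not> (b' = b \<or> [b' = a] (mod 2))"
      then show False
        using less.prems(2) \<open>b' \<in> S\<close> maximal \<open>b' \<le> b\<close> \<open>a \<le> a'\<close> b'(2)
        by (auto simp: source_closed_def dest!: bspec[of _ _ b'])
    qed
    then have first: "sum f {a'..b'} \<le> 0"
      using intervals \<open>a \<le> a'\<close> b'(2) \<open>b' \<le> b\<close> parity_a' by blast
    let ?T = "S - {a'..b'}"
    have "source_closed a b ?T"
      unfolding source_closed_def
    proof
      fix j assume j: "j \<in> {a..<b}"
      have "j \<in> S \<Longrightarrow> a' \<le> j" "j + 1 \<in> S \<Longrightarrow> j \<noteq> b'"
        using a'(2) maximal by auto
      then show "if [j = a] (mod 2) then j + 1 \<in> ?T \<longrightarrow> j \<in> ?T else j \<in> ?T \<longrightarrow> j + 1 \<in> ?T"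
        using less.prems(2) j by (auto simp: source_closed_def dest!: bspec[of _ _ j])
    qed
    moreover have "card ?T < card S"
      using b' fin a'(1) by (intro psubset_card_mono) auto
    ultimately have "sum f ?T \<le> 0"
      using less.hyps less.prems(1) by blast
    moreover have "sum f S = sum f ?T + sum f {a'..b'}"
      by (rule sum.subset_diff[OF b'(1) fin])
    ultimately show ?thesis using first by simp
  qed simp
qed

lemma sum_nonpos_iff_intervals:
  fixes f :: "nat \<Rightarrow> real"
  shows "(\<forall>S. S \<subseteq> {a..b} \<and> source_closed a b S \<longrightarrow> sum f S \<le> 0) \<longleftrightarrow>
    (\<forall>a' b'. a \<le> a' \<and> a' \<le> b' \<and> b' \<le> b \<and> [a' = a] (mod 2) \<and> (b' = b \<or> [b' = a] (mod 2)) \<longrightarrow>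
       sum f {a'..b'} \<le> 0)"
proof (intro iffI allI impI)
  fix a' b'
  assume "\<forall>S. S \<subseteq> {a..b} \<and> source_closed a b S \<longrightarrow> sum f S \<le> 0"
    and "a \<le> a' \<and> a' \<le> b' \<and> b' \<le> b \<and> [a' = a] (mod 2) \<and> (b' = b \<or> [b' = a] (mod 2))"
  then show "sum f {a'..b'} \<le> 0"
    using source_closed_interval[of a' a b' b] by auto
next
  fix S
  assume "\<forall>a' b'. a \<le> a' \<and> a' \<le> b' \<and> b' \<le> b \<and> [a' = a] (mod 2) \<and> (b' = b \<or> [b' = a] (mod 2)) \<longrightarrow>
       sum f {a'..b'} \<le> 0"
    and "S \<subseteq> {a..b} \<and> source_closed a b S"
  then show "sum f S \<le> 0"
    using sum_nonpos_if_source_closed[of a b f S] by blast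
qed


section \<open>Stability spaces of simple and string modules\<close>

lemma thin_on_simple: "thin_on {i} (simple_module i)"
  by (simp add: thin_on_def simple_module_def)

lemma thin_on_string: "thin_on {a..b} (string_module a b \<eta>)"
  by (simp add: thin_on_def string_module_def)

lemma closed_under_arrows_string:
  fixes \<eta> :: int
  assumes "b \<le> n"
  shows "closed_under_arrows n (string_module a b \<eta> :: ('k::field, 'k) rep) S \<longleftrightarrow>
    (\<forall>j\<in>{a..<b}. if beta_step a \<eta> j then j \<in> S \<longrightarrow> j + 1 \<in> S else j + 1 \<in> S \<longrightarrow> j \<in> S)"
proof -
  let ?M = "string_module a b \<eta> :: ('k, 'k) rep"
  have nontrivial: "\<not> (\<forall>x::'k. x = 0)"
    by (metis zero_neq_one)
  have rmap_eq_0: "(\<forall>x. rmap ?M (Beta j) x = 0) \<longleftrightarrow> \<not> (j \<in> {a..<b} \<and> beta_step a \<eta> j)"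
    "(\<forall>x. rmap ?M (Alpha j) x = 0) \<longleftrightarrow> \<not> (j \<in> {a..<b} \<and> \<not> beta_step a \<eta> j)" for j
    using nontrivial by (auto simp: string_module_def)
  have below: "j < n" if "j < b" for j
    using that assms by simp
  show ?thesis
    unfolding closed_under_arrows_def quiver_Q_simps(2) ball_Un ball_simps
    by (auto simp: quiver_Q_simps(3-) rmap_eq_0 Ball_def intro: below)
qed

lemma closed_under_arrows_string_minus:
  assumes "b \<le> n"
  shows "closed_under_arrows n (string_module a b (-1) :: ('k::field, 'k) rep) S \<longleftrightarrow> source_closed a b S"
  unfolding closed_under_arrows_string[OF assms] source_closed_def
  by (intro ball_cong refl) (simp add: beta_step_def)

lemma closed_under_arrows_string_plus:
  assumes "b \<le> n"
  shows "closed_under_arrows n (string_module a b 1 :: ('k::field, 'k) rep) S \<longleftrightarrow>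
    source_closed a b ({a..b} - S)"
  unfolding closed_under_arrows_string[OF assms] source_closed_def
  by (intro ball_cong refl) (auto simp: beta_step_def)

lemma stability_space_simple:
  assumes "n \<ge> 1" "i \<le> n"
  shows "stability_space n (simple_module i :: ('k::field, 'k) rep) =
    {v \<in> carrier_vec (n + 1). v $ i = 0}"
proof -
  have "semistable n v (simple_module i :: ('k, 'k) rep) \<longleftrightarrow> v $ i = 0" for v
    using assms by (subst semistable_thin_iff[OF assms(1) B_module_simple(1)[OF assms] thin_on_simple])
      (auto simp: subset_singleton_iff)
  then show ?thesis by (simp add: stability_space_def)
qed

lemma stability_space_string_minus:
  assumes "n \<ge> 1" "a < b" "b \<le> n"
  shows "stability_space n (string_module a b (-1) :: ('k::field, 'k) rep) =
    {v \<in> carrier_vec (n + 1). (\<Sum>i=a..b. v $ i) = 0 \<and>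
       (\<forall>a' b'. a \<le> a' \<and> a' \<le> b' \<and> b' \<le> b \<and> [a' = a] (mod 2) \<and> (b' = b \<or> [b' = a] (mod 2)) \<longrightarrow>
          (\<Sum>i=a'..b'. v $ i) \<le> 0)}"
proof -
  have "B_module n (string_module a b (-1) :: ('k, 'k) rep)" "{a..b} \<subseteq> {0..n}"
    using B_module_string[OF assms] assms(3) by auto
  note semistable_thin_iff[OF assms(1) this(1) thin_on_string this(2)]
  then show ?thesis
    unfolding stability_space_def
    by (simp only: closed_under_arrows_string_minus[OF assms(3)] sum_nonpos_iff_intervals)
qed

text \<open>
  The quotients of this module correspond to the source-closed sets, and semistability can be tested
  on quotients with the opposite sign. Replacing \<open>v\<close> by \<open>- v\<close> therefore brings back the interval
  criterion for \<open>\<eta> = -1\<close>.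
\<close>

lemma stability_space_string_plus:
  assumes "n \<ge> 1" "a < b" "b \<le> n"
  shows "stability_space n (string_module a b 1 :: ('k::field, 'k) rep) =
    {v \<in> carrier_vec (n + 1). (\<Sum>i=a..b. v $ i) = 0 \<and>
       (\<forall>a' b'. a \<le> a' \<and> a' \<le> b' \<and> b' \<le> b \<and> [a' = a] (mod 2) \<and> (b' = b \<or> [b' = a] (mod 2)) \<longrightarrow>
          (\<Sum>i=a'..b'. v $ i) \<ge> 0)}"
proof -
  have M: "B_module n (string_module a b 1 :: ('k, 'k) rep)" "{a..b} \<subseteq> {0..n}"
    using B_module_string[OF assms] assms(3) by auto
  have complement: "(\<forall>S. S \<subseteq> {a..b} \<and> source_closed a b ({a..b} - S) \<longrightarrow> (\<Sum>i\<in>S. v $ i) \<le> 0) \<longleftrightarrow>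
      (\<forall>T. T \<subseteq> {a..b} \<and> source_closed a b T \<longrightarrow> (\<Sum>i\<in>T. - v $ i) \<le> 0)"
    if "(\<Sum>i=a..b. v $ i) = 0" for v :: "real vec"
  proof -
    have sum_complement: "(\<Sum>i\<in>{a..b} - S. v $ i) = (\<Sum>i\<in>S. - v $ i)" if "S \<subseteq> {a..b}" for S
      using \<open>(\<Sum>i=a..b. v $ i) = 0\<close> that by (simp add: sum_diff finite_subset sum_negf)
    show ?thesis
    proof (intro iffI allI impI)
      fix T
      assume "\<forall>S. S \<subseteq> {a..b} \<and> source_closed a b ({a..b} - S) \<longrightarrow> (\<Sum>i\<in>S. v $ i) \<le> 0"
        and T: "T \<subseteq> {a..b} \<and> source_closed a b T"
      then have "(\<Sum>i\<in>{a..b} - T. v $ i) \<le> 0"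
        by (metis Diff_subset double_diff order_refl)
      with sum_complement T show "(\<Sum>i\<in>T. - v $ i) \<le> 0" by simp
    next
      fix S
      assume "\<forall>T. T \<subseteq> {a..b} \<and> source_closed a b T \<longrightarrow> (\<Sum>i\<in>T. - v $ i) \<le> 0"
        and S: "S \<subseteq> {a..b} \<and> source_closed a b ({a..b} - S)"
      then have "(\<Sum>i\<in>{a..b} - S. - v $ i) \<le> 0" by blast
      with sum_complement S show "(\<Sum>i\<in>S. v $ i) \<le> 0" by (simp add: sum_negf)
    qed
  qed
  show ?thesis
    unfolding stability_space_def semistable_thin_iff[OF assms(1) M(1) thin_on_string M(2)]
      closed_under_arrows_string_plus[OF assms(3)]
  proof (intro Collect_cong conj_cong refl)
    fix v :: "real vec"
    assume "(\<Sum>i=a..b. v $ i) = 0"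
    show "(\<forall>S. S \<subseteq> {a..b} \<and> source_closed a b ({a..b} - S) \<longrightarrow> (\<Sum>i\<in>S. v $ i) \<le> 0) \<longleftrightarrow>
       (\<forall>a' b'. a \<le> a' \<and> a' \<le> b' \<and> b' \<le> b \<and> [a' = a] (mod 2) \<and> (b' = b \<or> [b' = a] (mod 2)) \<longrightarrow>
          (\<Sum>i=a'..b'. v $ i) \<ge> 0)"
      unfolding complement[OF \<open>(\<Sum>i=a..b. v $ i) = 0\<close>] sum_nonpos_iff_intervals
      by (simp add: sum_negf)
  qed
qed

theorem theorem5p13:
  fixes n :: nat
  assumes "n \<ge> 1"
  shows
    "(\<forall>i. i \<le> n \<longrightarrow>
        stability_space n (simple_module i :: ('k::alg_closed_field, 'k) rep) =
          {v \<in> carrier_vec (n + 1). v $ i = 0}) \<and>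
     (\<forall>a b. a < b \<and> b \<le> n \<longrightarrow>
        stability_space n (string_module a b (-1) :: ('k, 'k) rep) =
          {v \<in> carrier_vec (n + 1). (\<Sum>i=a..b. v $ i) = 0 \<and>
             (\<forall>a' b'. a \<le> a' \<and> a' \<le> b' \<and> b' \<le> b \<and> [a' = a] (mod 2) \<and> (b' = b \<or> [b' = a] (mod 2)) \<longrightarrow>
                (\<Sum>i=a'..b'. v $ i) \<le> 0)}) \<and>
     (\<forall>a b. a < b \<and> b \<le> n \<longrightarrow>
        stability_space n (string_module a b 1 :: ('k, 'k) rep) =
          {v \<in> carrier_vec (n + 1). (\<Sum>i=a..b. v $ i) = 0 \<and>
             (\<forall>a' b'. a \<le> a' \<and> a' \<le> b' \<and> b' \<le> b \<and> [a' = a] (mod 2) \<and> (b' = b \<or> [b' = a] (mod 2)) \<longrightarrow>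
                (\<Sum>i=a'..b'. v $ i) \<ge> 0)})"
  by (intro conjI allI impI; (elim conjE)?)
    (rule stability_space_simple[OF assms] stability_space_string_minus[OF assms]
       stability_space_string_plus[OF assms]; assumption)+

end
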